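(* Let $X$ be a metrizable space. Then $\mathrm{Met}(X)$ is comeager in $(\mathrm{CPM}(X),\mathcal{D}_X)$. In particular, the space $(\mathrm{Met}(X),\mathcal{D}_X)$ is Baire.
   Context: A pseudometric on a set $X$ is a map $d\colon X\times X\to[0,\infty)$ with $d(x,x)=0$, $d(x,y)=d(y,x)$ and $d(x,y)\le d(x,z)+d(z,y)$ for all $x,y,z\in X$; it is a metric if $d(x,y)=0$ implies $x=y$. For a topological space $X$, $\mathrm{CPM}(X)$ denotes the set of all pseudometrics $d$ on $X$ that are continuous as maps $X\times X\to[0,\infty)$, and $\mathrm{Met}(X)\subseteq\mathrm{CPM}(X)$ denotes the set of all metrics on $X$ generating the same topology as that of $X$. Define $\mathcal{D}_X\colon \mathrm{CPM}(X)^2\to[0,\infty]$ by $\mathcal{D}_X(d,e)=\sup_{x,y\in X}|d(x,y)-e(x,y)|$; although it may take the value $\infty$, it induces a topology via open balls as for ordinary metrics. $\mathrm{CPM}(X)$ carries this topology, and $\mathrm{Met}(X)$ carries the topology induced by the restriction of $\mathcal{D}_X$ to $\mathrm{Met}(X)^2$, still written $\mathcal{D}_X$. A subset $S$ of a topological space $M$ is comeager if there is a sequence $\{G_n\}_{n\in\mathbb{Z}_{\ge0}}$ of open dense subsets of $M$ with $\bigcap_{n}G_n\subseteq S$. A non-empty topological space is Baire if every comeager subset of it is dense in it. *)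

theory Defs
  imports "HOL-Analysis.Analysis"
begin

section \<open>Continuous pseudometrics and admissible metrics\<close>

text \<open>A map on \<open>A \<times> A\<close> is encoded as a total function that vanishes off \<open>A \<times> A\<close>, so that each
  pseudometric on \<open>A\<close> has exactly one representative. The value 0 (rather than \<open>undefined\<close>) is used
  because \<open>Metric_space\<close> asks for non-negativity and symmetry at all arguments, not only
  those in the carrier.\<close>

definition zero_outside :: "'a set \<Rightarrow> ('a \<Rightarrow> 'a \<Rightarrow> real) \<Rightarrow> bool" where
  "zero_outside A d \<longleftrightarrow> (\<forall>x y. x \<notin> A \<or> y \<notin> A \<longrightarrow> d x y = 0)"

definition pseudometric_on :: "'a set \<Rightarrow> ('a \<Rightarrow> 'a \<Rightarrow> real) \<Rightarrow> bool" where
  "pseudometric_on A d \<longleftrightarrow>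
     (\<forall>x\<in>A. \<forall>y\<in>A. 0 \<le> d x y) \<and>
     (\<forall>x\<in>A. d x x = 0) \<and>
     (\<forall>x\<in>A. \<forall>y\<in>A. d x y = d y x) \<and>
     (\<forall>x\<in>A. \<forall>y\<in>A. \<forall>z\<in>A. d x y \<le> d x z + d z y)"

definition CPM :: "'a topology \<Rightarrow> ('a \<Rightarrow> 'a \<Rightarrow> real) set" where
  "CPM X = {d. zero_outside (topspace X) d \<and> pseudometric_on (topspace X) d \<and>
     continuous_map (prod_topology X X) (top_of_set {0..}) (\<lambda>(x, y). d x y)}"

definition Met :: "'a topology \<Rightarrow> ('a \<Rightarrow> 'a \<Rightarrow> real) set" where
  "Met X = {d. zero_outside (topspace X) d \<and> Metric_space (topspace X) d \<and>
     Metric_space.mtopology (topspace X) d = X}"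

lemma Metric_space_iff_pseudometric_on:
  assumes "zero_outside A d"
  shows "Metric_space A d \<longleftrightarrow>
    pseudometric_on A d \<and> (\<forall>x\<in>A. \<forall>y\<in>A. d x y = 0 \<longrightarrow> x = y)"
proof
  assume "Metric_space A d"
  then interpret Metric_space A d .
  show "pseudometric_on A d \<and> (\<forall>x\<in>A. \<forall>y\<in>A. d x y = 0 \<longrightarrow> x = y)"
    unfolding pseudometric_on_def by (auto intro: commute triangle)
next
  assume R: "pseudometric_on A d \<and> (\<forall>x\<in>A. \<forall>y\<in>A. d x y = 0 \<longrightarrow> x = y)"
  show "Metric_space A d"
  proof
    show "0 \<le> d x y" for x y
      using R assms unfolding pseudometric_on_def zero_outside_def
      by (cases "x \<in> A \<and> y \<in> A") auto
    show "d x y = d y x" for x y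
      using R assms unfolding pseudometric_on_def zero_outside_def
      by (cases "x \<in> A \<and> y \<in> A") auto
  qed (use R in \<open>auto simp: pseudometric_on_def\<close>)
qed

lemma Met_subset_CPM: "Met X \<subseteq> CPM X"
proof
  fix d assume d: "d \<in> Met X"
  then interpret Metric_space "topspace X" d by (simp add: Met_def)
  have top: "mtopology = X" and out: "zero_outside (topspace X) d"
    using d by (auto simp: Met_def)
  have "continuous_map (prod_topology X X) euclideanreal (\<lambda>p. d (fst p) (snd p))"
    using continuous_map_mdist[of "prod_topology X X" Self fst snd] top
    by (simp add: mtopology_of_def mdist_Self mspace_Self continuous_map_fst continuous_map_snd)
  then have "continuous_map (prod_topology X X) (top_of_set {0..}) (\<lambda>(x, y). d x y)"
    by (auto simp: continuous_map_in_subtopology case_prod_unfold)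
  then show "d \<in> CPM X"
    using out Metric_space_iff_pseudometric_on[OF out] Metric_space_axioms
    by (simp add: CPM_def)
qed


section \<open>The topology of an extended-valued distance\<close>

definition sup_dist :: "'a topology \<Rightarrow> ('a \<Rightarrow> 'a \<Rightarrow> real) \<Rightarrow> ('a \<Rightarrow> 'a \<Rightarrow> real) \<Rightarrow> ennreal" where
  "sup_dist X d e = (SUP (x, y) \<in> topspace X \<times> topspace X. ennreal \<bar>d x y - e x y\<bar>)"

text \<open>The analogue of \<open>Metric_space.mtopology\<close> for a distance with values in \<open>[0, \<infinity>]\<close>. Only the
  values of \<open>D\<close> on \<open>S \<times> S\<close> matter.\<close>

definition ball_topology :: "'b set \<Rightarrow> ('b \<Rightarrow> 'b \<Rightarrow> ennreal) \<Rightarrow> 'b topology" where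
  "ball_topology S D = topology (\<lambda>U. U \<subseteq> S \<and>
     (\<forall>d\<in>U. \<exists>r>0. {e \<in> S. D d e < ennreal r} \<subseteq> U))"

lemma openin_ball_topology:
  "openin (ball_topology S D) U \<longleftrightarrow>
     U \<subseteq> S \<and> (\<forall>d\<in>U. \<exists>r>0. {e \<in> S. D d e < ennreal r} \<subseteq> U)"
proof -
  have "istopology (\<lambda>U. U \<subseteq> S \<and> (\<forall>d\<in>U. \<exists>r>0. {e \<in> S. D d e < ennreal r} \<subseteq> U))"
    unfolding istopology_def
  proof (intro conjI allI impI ballI)
    fix U V d
    assume U: "U \<subseteq> S \<and> (\<forall>d\<in>U. \<exists>r>0. {e \<in> S. D d e < ennreal r} \<subseteq> U)"
      and V: "V \<subseteq> S \<and> (\<forall>d\<in>V. \<exists>r>0. {e \<in> S. D d e < ennreal r} \<subseteq> V)"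
    show "U \<inter> V \<subseteq> S" using U by blast
    assume d: "d \<in> U \<inter> V"
    obtain r s where r: "r > 0" "{e \<in> S. D d e < ennreal r} \<subseteq> U"
      and s: "s > 0" "{e \<in> S. D d e < ennreal s} \<subseteq> V"
      using U V d by blast
    have "{e \<in> S. D d e < ennreal (min r s)} \<subseteq> U \<inter> V"
      using r s by (auto simp: less_le_trans ennreal_leI subset_iff)
    then show "\<exists>r>0. {e \<in> S. D d e < ennreal r} \<subseteq> U \<inter> V"
      using r s by (intro exI[of _ "min r s"]) auto
  next
    fix K d
    assume K: "\<forall>U\<in>K. U \<subseteq> S \<and> (\<forall>d\<in>U. \<exists>r>0. {e \<in> S. D d e < ennreal r} \<subseteq> U)"
    show "\<Union>K \<subseteq> S" using K by blast
    assume "d \<in> \<Union>K"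
    then obtain U where U: "U \<in> K" "d \<in> U" by blast
    then obtain r where "r > 0" "{e \<in> S. D d e < ennreal r} \<subseteq> U" using K by blast
    then show "\<exists>r>0. {e \<in> S. D d e < ennreal r} \<subseteq> \<Union>K"
      using U by (intro exI[of _ r]) auto
  qed
  then show ?thesis
    by (simp add: ball_topology_def topology_inverse')
qed

lemma topspace_ball_topology [simp]: "topspace (ball_topology S D) = S"
proof
  show "topspace (ball_topology S D) \<subseteq> S"
    using openin_topspace openin_ball_topology by metis
  have "openin (ball_topology S D) S"
    unfolding openin_ball_topology by (auto intro: exI[of _ 1])
  then show "S \<subseteq> topspace (ball_topology S D)"
    by (rule openin_subset)
qed


section \<open>Comeager sets and Baire spaces\<close>

definition dense_in :: "'b topology \<Rightarrow> 'b set \<Rightarrow> bool" where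
  "dense_in T S \<longleftrightarrow> S \<subseteq> topspace T \<and> T closure_of S = topspace T"

definition comeager_in :: "'b topology \<Rightarrow> 'b set \<Rightarrow> bool" where
  "comeager_in T S \<longleftrightarrow> S \<subseteq> topspace T \<and>
     (\<exists>G :: nat \<Rightarrow> 'b set. (\<forall>n. openin T (G n) \<and> dense_in T (G n)) \<and> (\<Inter>n. G n) \<subseteq> S)"

definition Baire_space :: "'b topology \<Rightarrow> bool" where
  "Baire_space T \<longleftrightarrow> topspace T \<noteq> {} \<and> (\<forall>S. comeager_in T S \<longrightarrow> dense_in T S)"

end

theory Submission
  imports Defs
begin

text \<open>
  Fix an admissible metric \<open>w \<le> 1\<close> on \<open>X\<close>. A continuous pseudometric \<open>d\<close> is an admissible
  metric as soon as smallness of \<open>d\<close> forces smallness of \<open>w\<close>, uniformly over all pairs of points: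
  then the topology of \<open>d\<close> is finer than that of \<open>w\<close>, while continuity makes it coarser
  (\<open>Met_if_refines_admissible\<close>). This sufficient condition splits into countably many scales: for
  every \<open>n\<close> the distance \<open>d x y\<close> must stay above some \<open>r > 0\<close> on all pairs with
  \<open>w x y \<ge> 1 / (n + 1)\<close>. Requiring it uniformly, rather than point by point, makes each scale an
  open condition for the uniform distance (\<open>openin_separating_at\<close>), at the price of discarding
  some admissible metrics. Each scale is also a dense condition, since \<open>d + c w\<close> satisfies it
  for every \<open>c > 0\<close> and differs from \<open>d\<close> by at most \<open>c\<close> (\<open>dense_in_separating_at\<close>). Hence the
  admissible metrics are comeager.

  Uniform limits of continuous pseudometrics are continuous pseudometrics, so capping the
  extended distance at 1 turns the space of continuous pseudometrics into a complete metric space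
  (\<open>CPM_complete\<close>), and it is Baire by the category theorem. The second claim follows because a
  comeager subspace of a Baire space is Baire (\<open>Baire_space_comeager_subtopology\<close>).
\<close>

section \<open>Baire spaces\<close>

lemma dense_in_iff_meets_open:
  "dense_in T S \<longleftrightarrow> S \<subseteq> topspace T \<and> (\<forall>U. openin T U \<and> U \<noteq> {} \<longrightarrow> S \<inter> U \<noteq> {})"
  by (simp add: dense_in_def dense_intersects_open)

lemma (in Metric_space) mcomplete_imp_Baire_space:
  assumes mcomplete and "M \<noteq> {}"
  shows "Baire_space mtopology"
  unfolding Baire_space_def
proof (intro conjI allI impI)
  show "topspace mtopology \<noteq> {}" using assms by simp
  fix S assume "comeager_in mtopology S"
  then obtain G :: "nat \<Rightarrow> 'a set" where S: "S \<subseteq> topspace mtopology" "(\<Inter>n. G n) \<subseteq> S"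
    and G: "\<And>n. openin mtopology (G n)" "\<And>n. dense_in mtopology (G n)"
    unfolding comeager_in_def by blast
  have "mtopology closure_of \<Inter>(range G) = M"
    using G by (intro metric_Baire_category) (auto simp: dense_in_def assms)
  then show "dense_in mtopology S"
    using S closure_of_mono[OF S(2), of mtopology] closure_of_subset_topspace[of mtopology S]
    by (simp add: dense_in_def subset_antisym)
qed

text \<open>Relatively open dense sets in \<open>M\<close> are traces of open sets, and these are dense in the whole
  space because \<open>M\<close> is. Together with the open dense sets whose intersection lies in \<open>M\<close> they
  witness that a set comeager in \<open>M\<close> is comeager, hence dense, in the whole space; a dense set
  contained in \<open>M\<close> is dense in \<open>M\<close>.\<close>
lemma Baire_space_comeager_subtopology:
  assumes T: "Baire_space T" and M: "comeager_in T M"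
  shows "Baire_space (subtopology T M)"
  unfolding Baire_space_def
proof (intro conjI allI impI)
  have dense: "dense_in T M" and MT: "M \<subseteq> topspace T"
    using T M by (auto simp: Baire_space_def comeager_in_def)
  have "topspace T \<noteq> {}" using T by (simp add: Baire_space_def)
  then show "topspace (subtopology T M) \<noteq> {}"
    using dense MT unfolding dense_in_def by (metis closure_of_empty inf.absorb2 topspace_subtopology)
  fix S assume "comeager_in (subtopology T M) S"
  then obtain G :: "nat \<Rightarrow> 'a set" where S: "S \<subseteq> M" "(\<Inter>n. G n) \<subseteq> S"
    and G: "\<And>n. openin (subtopology T M) (G n)" "\<And>n. dense_in (subtopology T M) (G n)"
    unfolding comeager_in_def using MT by auto
  obtain K :: "nat \<Rightarrow> 'a set" where K: "\<And>n. openin T (K n) \<and> dense_in T (K n)" "(\<Inter>n. K n) \<subseteq> M"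
    using M unfolding comeager_in_def by blast
  have "\<forall>n. \<exists>H. openin T H \<and> G n = H \<inter> M"
    using G(1) by (auto simp: openin_subtopology)
  then obtain H where H: "\<And>n. openin T (H n)" "\<And>n. G n = H n \<inter> M"
    by metis
  \<comment> \<open>A non-empty open set meets the dense set \<open>M\<close> in a non-empty relatively open set,
     which in turn meets \<open>G n\<close>.\<close>
  have H_dense: "dense_in T (H n)" for n
    unfolding dense_in_iff_meets_open
  proof (intro conjI allI impI)
    show "H n \<subseteq> topspace T" using H(1) by (rule openin_subset)
    fix U assume U: "openin T U \<and> U \<noteq> {}"
    then have "M \<inter> U \<noteq> {}" using dense by (simp add: dense_in_iff_meets_open)
    moreover have "openin (subtopology T M) (M \<inter> U)"
      using U by (simp add: openin_subtopology_Int2)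
    ultimately have "G n \<inter> (M \<inter> U) \<noteq> {}"
      using G(2)[of n] by (simp add: dense_in_iff_meets_open)
    then show "H n \<inter> U \<noteq> {}" using H(2) by blast
  qed
  \<comment> \<open>Interleaving turns the two sequences \<open>K\<close> and \<open>H\<close> into one.\<close>
  have "(\<Inter>n. (if even n then K (n div 2) else H (n div 2))) \<subseteq> S" (is "(\<Inter>n. ?L n) \<subseteq> S")
  proof
    fix x assume x: "x \<in> (\<Inter>n. ?L n)"
    have "x \<in> ?L (2 * n)" "x \<in> ?L (2 * n + 1)" for n using x by blast+
    then have "x \<in> K n" "x \<in> H n" for n by simp_all
    then show "x \<in> S" using K(2) H(2) S(2) by blast
  qed
  then have "comeager_in T S"
    unfolding comeager_in_def using S(1) MT K(1) H(1) H_dense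
    by (intro conjI exI[of _ ?L]) auto
  then have S_dense: "dense_in T S" using T by (simp add: Baire_space_def)
  show "dense_in (subtopology T M) S"
    unfolding dense_in_iff_meets_open
  proof (intro conjI allI impI)
    show "S \<subseteq> topspace (subtopology T M)" using S(1) MT by auto
    fix V assume V: "openin (subtopology T M) V \<and> V \<noteq> {}"
    then obtain W where W: "openin T W" "V = W \<inter> M"
      by (auto simp: openin_subtopology)
    then have "S \<inter> W \<noteq> {}"
      using V S_dense by (auto simp: dense_in_iff_meets_open)
    then show "S \<inter> V \<noteq> {}" using W S(1) by blast
  qed
qed

section \<open>The distance on continuous pseudometrics\<close>

lemma sup_dist_le_iff:
  assumes "0 \<le> r"
  shows "sup_dist X d e \<le> ennreal r \<longleftrightarrow>
    (\<forall>x\<in>topspace X. \<forall>y\<in>topspace X. \<bar>d x y - e x y\<bar> \<le> r)"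
  using assms by (auto simp: sup_dist_def SUP_le_iff ennreal_le_iff)

lemma sup_dist_lessD:
  assumes "sup_dist X d e < ennreal r" "x \<in> topspace X" "y \<in> topspace X"
  shows "\<bar>d x y - e x y\<bar> < r"
proof -
  have "ennreal \<bar>d x y - e x y\<bar> \<le> sup_dist X d e"
    unfolding sup_dist_def using assms by (intro SUP_upper2[of "(x, y)"]) auto
  then have "ennreal \<bar>d x y - e x y\<bar> < ennreal r" using assms(1) by (rule le_less_trans)
  then show ?thesis by (simp add: ennreal_less_iff)
qed

lemma sup_dist_commute: "sup_dist X d e = sup_dist X e d"
  by (simp add: sup_dist_def abs_minus_commute)

lemma sup_dist_triangle: "sup_dist X d f \<le> sup_dist X d e + sup_dist X e f"
  unfolding sup_dist_def[of X d f]
proof (rule SUP_least, clarify)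
  fix x y assume xy: "x \<in> topspace X" "y \<in> topspace X"
  have "ennreal \<bar>d x y - f x y\<bar> \<le> ennreal \<bar>d x y - e x y\<bar> + ennreal \<bar>e x y - f x y\<bar>"
    by (simp flip: ennreal_plus)
  also have "\<dots> \<le> sup_dist X d e + sup_dist X e f"
    unfolding sup_dist_def using xy by (intro add_mono SUP_upper2[of "(x, y)"]) auto
  finally show "ennreal \<bar>d x y - f x y\<bar> \<le> sup_dist X d e + sup_dist X e f" .
qed

lemma sup_dist_eq_0_imp_eq:
  assumes "zero_outside (topspace X) d" "zero_outside (topspace X) e" "sup_dist X d e = 0"
  shows "d = e"
proof (intro ext)
  fix x y
  show "d x y = e x y"
    using sup_dist_le_iff[of 0 X d e] assms
    by (cases "x \<in> topspace X \<and> y \<in> topspace X") (auto simp: zero_outside_def)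
qed

text \<open>Capping makes the extended distance real-valued, so that the theory of metric spaces applies;
  balls of radius at most 1, and thus the topology, are unchanged.\<close>
definition capped_sup_dist where
  "capped_sup_dist X d e = enn2real (min 1 (sup_dist X d e))"

lemma ennreal_capped_sup_dist: "ennreal (capped_sup_dist X d e) = min 1 (sup_dist X d e)"
  unfolding capped_sup_dist_def
  by (rule ennreal_enn2real) (simp add: min_less_iff_disj)

lemma capped_sup_dist_less_iff:
  assumes "r \<le> 1"
  shows "capped_sup_dist X d e < r \<longleftrightarrow> sup_dist X d e < ennreal r"
proof -
  have "capped_sup_dist X d e < r \<longleftrightarrow> min 1 (sup_dist X d e) < ennreal r"
    unfolding ennreal_capped_sup_dist[symmetric] 
    by (simp add: ennreal_less_iff capped_sup_dist_def)
  moreover have "ennreal r \<le> 1" using assms by simp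
  ultimately show ?thesis by (auto simp: min_less_iff_disj)
qed

lemma Metric_space_CPM: "Metric_space (CPM X) (capped_sup_dist X)"
proof
  fix d e f :: "'a \<Rightarrow> 'a \<Rightarrow> real"
  show "0 \<le> capped_sup_dist X d e" by (simp add: capped_sup_dist_def)
  show "capped_sup_dist X d e = capped_sup_dist X e d"
    by (simp add: capped_sup_dist_def sup_dist_commute)
  have self: "sup_dist X d d = 0" 
    using sup_dist_le_iff[of 0 X d d] by simp
  show "capped_sup_dist X d e = 0 \<longleftrightarrow> d = e" if "d \<in> CPM X" "e \<in> CPM X"
  proof
    assume "capped_sup_dist X d e = 0"
    then have "min 1 (sup_dist X d e) = 0"
      using ennreal_capped_sup_dist[of X d e] by simp
    then have "sup_dist X d e = 0" by (simp add: min_def split: if_splits)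
    then show "d = e" using that by (intro sup_dist_eq_0_imp_eq[of X]) (auto simp: CPM_def)
  qed (use self in \<open>simp add: capped_sup_dist_def\<close>)
  have "min 1 (sup_dist X d f) \<le> min 1 (sup_dist X d e) + min 1 (sup_dist X e f)"
    using sup_dist_triangle[of X d f e] by (auto simp: min_def add_increasing add_increasing2 intro: order_trans)
  then show "capped_sup_dist X d f \<le> capped_sup_dist X d e + capped_sup_dist X e f"
    unfolding ennreal_capped_sup_dist[symmetric]
    by (simp add: capped_sup_dist_def flip: ennreal_plus)
qed

lemma mtopology_capped_sup_dist:
  assumes "S \<subseteq> CPM X"
  shows "Metric_space.mtopology S (capped_sup_dist X) = ball_topology S (sup_dist X)"
proof -
  interpret Metric_space S "capped_sup_dist X"
    using Metric_space.subspace[OF Metric_space_CPM assms] .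
  have "(\<exists>r>0. mball d r \<subseteq> U) \<longleftrightarrow> (\<exists>r>0. {e \<in> S. sup_dist X d e < ennreal r} \<subseteq> U)"
    if "d \<in> S" for d U
  proof -
    have eq: "mball d r = {e \<in> S. sup_dist X d e < ennreal r}" if "r \<le> 1" for r
      using that \<open>d \<in> S\<close> by (auto simp: capped_sup_dist_less_iff)
    have mono: "{e \<in> S. sup_dist X d e < ennreal (min 1 r)} \<subseteq> {e \<in> S. sup_dist X d e < ennreal r}" for r
      by (clarsimp, erule less_le_trans) (simp add: ennreal_leI)
    show ?thesis
    proof
      assume "\<exists>r>0. mball d r \<subseteq> U"
      then obtain r where "r > 0" "mball d r \<subseteq> U" by blast
      moreover have "mball d (min 1 r) \<subseteq> mball d r" by (rule mball_subset_concentric) simp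
      ultimately show "\<exists>r>0. {e \<in> S. sup_dist X d e < ennreal r} \<subseteq> U"
        using eq[of "min 1 r"] by (intro exI[of _ "min 1 r"]) auto
    next
      assume "\<exists>r>0. {e \<in> S. sup_dist X d e < ennreal r} \<subseteq> U"
      then obtain r where "r > 0" "{e \<in> S. sup_dist X d e < ennreal r} \<subseteq> U" by blast
      then show "\<exists>r>0. mball d r \<subseteq> U"
        using eq[of "min 1 r"] mono[of r] by (intro exI[of _ "min 1 r"]) auto
    qed
  qed
  then show ?thesis
    by (auto simp: topology_eq openin_mtopology openin_ball_topology subset_iff Ball_def)
qed

text \<open>The two spaces of the theorem are built independently from balls; this identifies one as a
  subspace of the other, which is what the transfer of the Baire property needs.\<close>
lemma ball_topology_Met:
  "ball_topology (Met X) (sup_dist X) = subtopology (ball_topology (CPM X) (sup_dist X)) (Met X)"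
proof -
  interpret Submetric "CPM X" "capped_sup_dist X" "Met X"
    by (intro Submetric.intro Metric_space_CPM Submetric_axioms.intro Met_subset_CPM)
  show ?thesis
    using mtopology_submetric by (simp add: mtopology_capped_sup_dist Met_subset_CPM)
qed

lemma CPM_iff:
  "d \<in> CPM X \<longleftrightarrow> zero_outside (topspace X) d \<and> pseudometric_on (topspace X) d \<and>
     continuous_map (prod_topology X X) euclideanreal (\<lambda>(x, y). d x y)"
  by (auto simp: CPM_def pseudometric_on_def continuous_map_in_subtopology)

lemma CPM_nonempty: "CPM X \<noteq> {}"
proof -
  have "(\<lambda>x y. 0) \<in> CPM X"
    by (simp add: CPM_iff zero_outside_def pseudometric_on_def case_prod_unfold)
  then show ?thesis by blast
qed

text \<open>A Cauchy sequence converges uniformly to a continuous function on the product, and the defining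
  (in)equalities of a pseudometric survive pointwise limits.\<close>
lemma CPM_complete: "Metric_space.mcomplete (CPM X) (capped_sup_dist X)"
proof -
  interpret Metric_space "CPM X" "capped_sup_dist X" by (rule Metric_space_CPM)
  show ?thesis
    unfolding mcomplete_def
  proof (intro allI impI)
    fix \<sigma> assume \<sigma>: "MCauchy \<sigma>"
    then have CPM: "\<sigma> n \<in> CPM X" for n by (auto simp: MCauchy_def)
    have Cauchy: "\<exists>N. \<forall>m n p. N \<le> m \<longrightarrow> N \<le> n \<longrightarrow> p \<in> topspace (prod_topology X X) \<longrightarrow>
        dist (case p of (x, y) \<Rightarrow> \<sigma> m x y) (case p of (x, y) \<Rightarrow> \<sigma> n x y) < \<epsilon>"
      if "\<epsilon> > 0" for \<epsilon>
    proof -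
      obtain N where "\<forall>m n. N \<le> m \<longrightarrow> N \<le> n \<longrightarrow> capped_sup_dist X (\<sigma> m) (\<sigma> n) < min 1 \<epsilon>"
        using \<sigma> \<open>\<epsilon> > 0\<close> unfolding MCauchy_def by (metis min_less_iff_conj zero_less_one)
      then have "sup_dist X (\<sigma> m) (\<sigma> n) < ennreal (min 1 \<epsilon>)" if "N \<le> m" "N \<le> n" for m n
        using that capped_sup_dist_less_iff[of "min 1 \<epsilon>" X] by simp
      then have "\<bar>\<sigma> m x y - \<sigma> n x y\<bar> < min 1 \<epsilon>"
        if "N \<le> m" "N \<le> n" "x \<in> topspace X" "y \<in> topspace X" for m n x y
        using that by (intro sup_dist_lessD[of X]) auto
      then show ?thesis by (intro exI[of _ N]) (auto simp: dist_real_def)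
    qed
    obtain g where g: "continuous_map (prod_topology X X) euclideanreal g"
      and lim: "\<And>\<epsilon>. \<epsilon> > 0 \<Longrightarrow> \<forall>\<^sub>F n in sequentially. \<forall>p\<in>topspace (prod_topology X X).
        dist (case p of (x, y) \<Rightarrow> \<sigma> n x y) (g p) < \<epsilon>"
    proof (rule Met_TC.continuous_map_uniformly_Cauchy_limit
        [where X = "prod_topology X X" and f = "\<lambda>n (x, y). \<sigma> n x y"])
      show "Met_TC.mcomplete TYPE(real)"
        by (simp add: complete_UNIV)
      show "\<forall>\<^sub>F n in sequentially. continuous_map (prod_topology X X) Met_TC.mtopology (\<lambda>(x, y). \<sigma> n x y)"
        using CPM by (simp add: CPM_iff)
    qed (use Cauchy in auto)
    \<comment> \<open>The uniform limit is determined only on pairs of points of \<open>X\<close>; elsewhere the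
       representative in \<open>CPM X\<close> has to vanish.\<close>
    define d where "d x y = (if x \<in> topspace X \<and> y \<in> topspace X then g (x, y) else 0)" for x y
    have tends: "(\<lambda>n. \<sigma> n x y) \<longlonglongrightarrow> d x y" if "x \<in> topspace X" "y \<in> topspace X" for x y
      unfolding tendsto_iff
    proof (intro allI impI)
      fix \<epsilon> :: real assume "\<epsilon> > 0"
      from lim[OF this] show "\<forall>\<^sub>F n in sequentially. dist (\<sigma> n x y) (d x y) < \<epsilon>"
        by eventually_elim (use that in \<open>auto simp: d_def\<close>)
    qed
    have pm: "pseudometric_on (topspace X) (\<sigma> n)" for n
      using CPM by (simp add: CPM_iff)
    have "d \<in> CPM X"
      unfolding CPM_iff
    proof (intro conjI)
      show "zero_outside (topspace X) d" by (simp add: zero_outside_def d_def)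
      show "continuous_map (prod_topology X X) euclideanreal (\<lambda>(x, y). d x y)"
        by (rule continuous_map_eq[OF g]) (auto simp: d_def)
      show "pseudometric_on (topspace X) d"
        unfolding pseudometric_on_def
      proof (intro conjI ballI)
        fix x y z assume X: "x \<in> topspace X" "y \<in> topspace X" "z \<in> topspace X"
        show "d x y \<le> d x z + d z y"
        proof (rule LIMSEQ_le[OF tends tendsto_add[OF tends tends]])
          have "\<sigma> n x y \<le> \<sigma> n x z + \<sigma> n z y" for n
            using X pm[of n] unfolding pseudometric_on_def by blast
          then show "\<exists>N. \<forall>n\<ge>N. \<sigma> n x y \<le> \<sigma> n x z + \<sigma> n z y" by blast
        qed (use X in auto)
      next
        fix x y assume X: "x \<in> topspace X" "y \<in> topspace X"
        show "0 \<le> d x y"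
          using X pm by (intro LIMSEQ_le_const[OF tends]) (auto simp: pseudometric_on_def)
        have "(\<lambda>n. \<sigma> n x y) = (\<lambda>n. \<sigma> n y x)"
          using X pm by (auto simp: pseudometric_on_def)
        then show "d x y = d y x"
          using X tends[of x y] tends[of y x] LIMSEQ_unique by metis
      next
        fix x assume X: "x \<in> topspace X"
        have "(\<lambda>n. \<sigma> n x x) = (\<lambda>n. 0)"
          using X pm by (auto simp: pseudometric_on_def)
        then show "d x x = 0"
          using tends[OF X X] by (simp add: LIMSEQ_const_iff)
      qed
    qed
    moreover have "\<forall>\<^sub>F n in sequentially. \<sigma> n \<in> CPM X \<and> capped_sup_dist X (\<sigma> n) d < \<epsilon>"
      if "\<epsilon> > 0" for \<epsilon>
    proof -
      \<comment> \<open>The supremum only inherits a non-strict bound, whence a radius below \<open>\<epsilon>\<close>; staying below 1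
         keeps the cap out of play.\<close>
      define r where "r = min 1 \<epsilon> / 2"
      have r: "r > 0" "r < 1" "r < \<epsilon>" using that by (auto simp: r_def)
      from lim[OF r(1)] show ?thesis
      proof eventually_elim
        case (elim n)
        then have "sup_dist X (\<sigma> n) d \<le> ennreal r"
          using r by (force simp: sup_dist_le_iff d_def dist_real_def intro: less_imp_le)
        also have "\<dots> < ennreal (min 1 \<epsilon>)"
          using r by (intro ennreal_lessI) auto
        finally show ?case
          using CPM capped_sup_dist_less_iff[of "min 1 \<epsilon>" X "\<sigma> n" d] by simp
      qed
    qed
    ultimately show "\<exists>d. limitin mtopology \<sigma> d sequentially"
      by (auto simp: limitin_metric)
  qed
qed

lemma Baire_space_CPM: "Baire_space (ball_topology (CPM X) (sup_dist X))"
  using Metric_space.mcomplete_imp_Baire_space[OF Metric_space_CPM CPM_complete CPM_nonempty]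
  by (simp add: mtopology_capped_sup_dist)

section \<open>Recognizing and producing admissible metrics\<close>

lemma CPM_add_scaled:
  assumes d: "d \<in> CPM X" and w: "w \<in> CPM X" and "0 \<le> c"
  shows "(\<lambda>x y. d x y + c * w x y) \<in> CPM X"
  unfolding CPM_iff
proof (intro conjI)
  show "zero_outside (topspace X) (\<lambda>x y. d x y + c * w x y)"
    using d w by (simp add: CPM_iff zero_outside_def)
  show "continuous_map (prod_topology X X) euclideanreal (\<lambda>(x, y). d x y + c * w x y)"
    using d w unfolding CPM_iff case_prod_unfold
    by (intro continuous_map_add continuous_map_real_mult_left) auto
  have d': "pseudometric_on (topspace X) d" and w': "pseudometric_on (topspace X) w"
    using d w by (auto simp: CPM_iff)
  show "pseudometric_on (topspace X) (\<lambda>x y. d x y + c * w x y)"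
    unfolding pseudometric_on_def
  proof (intro conjI ballI)
    fix x y z assume X: "x \<in> topspace X" "y \<in> topspace X" "z \<in> topspace X"
    have "d x y \<le> d x z + d z y" "w x y \<le> w x z + w z y"
      using d' w' X by (auto simp: pseudometric_on_def)
    then show "d x y + c * w x y \<le> (d x z + c * w x z) + (d z y + c * w z y)"
      using mult_left_mono[OF _ \<open>0 \<le> c\<close>, of "w x y" "w x z + w z y"] by (simp add: distrib_left)
  qed (use d' w' \<open>0 \<le> c\<close> in \<open>auto simp: pseudometric_on_def\<close>)
qed

text \<open>Continuity of \<open>d\<close> makes its balls open in \<open>X\<close>, so its topology is coarser than that of \<open>X\<close>. The
  hypothesis puts a ball of \<open>d\<close> inside every ball of \<open>w\<close>, which gives the converse and also keeps
  distinct points at positive distance.\<close>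
lemma Met_if_refines_admissible:
  assumes d: "d \<in> CPM X" and w: "w \<in> Met X"
    and refines: "\<And>\<epsilon>. \<epsilon> > 0 \<Longrightarrow>
      \<exists>r>0. \<forall>x\<in>topspace X. \<forall>y\<in>topspace X. d x y < r \<longrightarrow> w x y < \<epsilon>"
  shows "d \<in> Met X"
proof -
  interpret W: Metric_space "topspace X" w using w by (simp add: Met_def)
  have W_top: "W.mtopology = X" using w by (simp add: Met_def)
  have out: "zero_outside (topspace X) d" and pm: "pseudometric_on (topspace X) d"
    and cont: "continuous_map (prod_topology X X) euclideanreal (\<lambda>(x, y). d x y)"
    using d by (auto simp: CPM_iff)
  have separates: "x = y" if X: "x \<in> topspace X" "y \<in> topspace X" and "d x y = 0" for x y
  proof (rule ccontr)
    assume "x \<noteq> y"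
    then have "w x y > 0" using X by simp
    then show False using refines[of "w x y"] that by force
  qed
  have "Metric_space (topspace X) d"
    using separates pm by (auto simp: Metric_space_iff_pseudometric_on[OF out])
  then interpret D: Metric_space "topspace X" d .
  have "openin D.mtopology U \<longleftrightarrow> openin X U" for U
  proof
    assume U: "openin D.mtopology U"
    show "openin X U"
    proof (subst openin_subopen, intro ballI)
      fix x assume "x \<in> U"
      then obtain r where r: "r > 0" "D.mball x r \<subseteq> U" and x: "x \<in> topspace X"
        using U unfolding D.openin_mtopology by blast
      have "continuous_map X (prod_topology X X) (\<lambda>y. (x, y))"
        using x by (simp add: continuous_map_pairwise o_def)
      from continuous_map_compose[OF this cont]
      have "continuous_map X euclideanreal (\<lambda>y. d x y)" by (simp add: o_def)
      from openin_continuous_map_preimage[OF this, of "{..<r}"]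
      have "openin X {y \<in> topspace X. d x y < r}" by simp
      moreover have "{y \<in> topspace X. d x y < r} = D.mball x r" using x by auto
      ultimately show "\<exists>T. openin X T \<and> x \<in> T \<and> T \<subseteq> U"
        using r x by (intro exI[of _ "D.mball x r"]) auto
    qed
  next
    assume "openin X U"
    then have U: "openin W.mtopology U" by (simp add: W_top)
    show "openin D.mtopology U"
      unfolding D.openin_mtopology
    proof (intro conjI allI impI)
      show "U \<subseteq> topspace X" using U by (simp add: W.openin_mtopology)
      fix x assume "x \<in> U"
      then obtain \<epsilon> where "\<epsilon> > 0" and \<epsilon>: "W.mball x \<epsilon> \<subseteq> U"
        using U unfolding W.openin_mtopology by blast
      from refines[OF \<open>\<epsilon> > 0\<close>] obtain r where "r > 0"
        and "\<forall>x\<in>topspace X. \<forall>y\<in>topspace X. d x y < r \<longrightarrow> w x y < \<epsilon>" by blast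
      then have "D.mball x r \<subseteq> W.mball x \<epsilon>" by auto
      with \<epsilon> \<open>r > 0\<close> show "\<exists>r>0. D.mball x r \<subseteq> U" by blast
    qed
  qed
  then have "D.mtopology = X" by (simp add: topology_eq)
  then show ?thesis using out D.Metric_space_axioms by (simp add: Met_def)
qed

text \<open>Boundedness is what makes small multiples of this metric uniformly small perturbations.\<close>
lemma bounded_admissible_metric_exists:
  assumes "metrizable_space X"
  obtains w where "w \<in> Met X" "\<And>x y. w x y \<le> 1"
proof -
  obtain M m where "Metric_space M m" and X: "X = Metric_space.mtopology M m"
    using assms by (auto simp: metrizable_space_def)
  then interpret m: Metric_space M m by simp
  have M: "topspace X = M" using X by simp
  interpret C: Metric_space M "m.capped_dist 1" by (rule m.capped_dist)
  \<comment> \<open>The given metric need not vanish at points outside \<open>M\<close>, but members of \<open>Met X\<close> must.\<close>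
  define w where "w x y = (if x \<in> M \<and> y \<in> M then m.capped_dist 1 x y else 0)" for x y
  interpret w: Metric_space M w
    by standard (auto simp: w_def C.commute intro: C.triangle)
  have "w.mball x r = C.mball x r" for x r
    by (auto simp: w_def)
  then have "w.mtopology = C.mtopology"
    by (simp add: topology_eq w.openin_mtopology C.openin_mtopology)
  also have "\<dots> = X" by (simp add: X m.mtopology_capped_metric)
  finally have "w \<in> Met X"
    using w.Metric_space_axioms M by (simp add: Met_def zero_outside_def w_def)
  moreover have "w x y \<le> 1" for x y
    by (simp add: w_def m.capped_dist_def)
  ultimately show ?thesis by (rule that)
qed

section \<open>Comeagerness of the admissible metrics\<close>

text \<open>The bound \<open>r\<close> is chosen before the points: this uniformity is what a perturbation that is small
  in the uniform distance preserves.\<close>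
definition separating_at :: "'a topology \<Rightarrow> ('a \<Rightarrow> 'a \<Rightarrow> real) \<Rightarrow> real \<Rightarrow> ('a \<Rightarrow> 'a \<Rightarrow> real) set" where
  "separating_at X w \<epsilon> = {d \<in> CPM X. \<exists>r>0. \<forall>x\<in>topspace X. \<forall>y\<in>topspace X. \<epsilon> \<le> w x y \<longrightarrow> r \<le> d x y}"

text \<open>Moving \<open>d\<close> by less than half of its lower bound leaves the other half as a lower bound.\<close>
lemma openin_separating_at:
  "openin (ball_topology (CPM X) (sup_dist X)) (separating_at X w \<epsilon>)"
  unfolding openin_ball_topology
proof (intro conjI ballI)
  show "separating_at X w \<epsilon> \<subseteq> CPM X" by (auto simp: separating_at_def)
  fix d assume "d \<in> separating_at X w \<epsilon>"
  then obtain r where "r > 0"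
    and r: "\<And>x y. x \<in> topspace X \<Longrightarrow> y \<in> topspace X \<Longrightarrow> \<epsilon> \<le> w x y \<Longrightarrow> r \<le> d x y"
    unfolding separating_at_def by blast
  have "e \<in> separating_at X w \<epsilon>" if e: "e \<in> CPM X" "sup_dist X d e < ennreal (r / 2)" for e
  proof -
    have "r / 2 \<le> e x y" if "x \<in> topspace X" "y \<in> topspace X" "\<epsilon> \<le> w x y" for x y
      using r[OF that] sup_dist_lessD[OF e(2) that(1,2)] by (simp add: abs_if split: if_splits)
    then show ?thesis
      using e(1) \<open>r > 0\<close> unfolding separating_at_def
      by (intro CollectI conjI exI[of _ "r / 2"]) auto
  qed
  then show "\<exists>r>0. {e \<in> CPM X. sup_dist X d e < ennreal r} \<subseteq> separating_at X w \<epsilon>"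
    using \<open>r > 0\<close> by (intro exI[of _ "r / 2"]) auto
qed

text \<open>Adding a small multiple of \<open>w\<close> to any pseudometric supplies the lower bound.\<close>
lemma dense_in_separating_at:
  assumes w: "w \<in> CPM X" and bound: "\<And>x y. w x y \<le> 1" and "\<epsilon> > 0"
  shows "dense_in (ball_topology (CPM X) (sup_dist X)) (separating_at X w \<epsilon>)"
  unfolding dense_in_iff_meets_open
proof (intro conjI allI impI)
  show "separating_at X w \<epsilon> \<subseteq> topspace (ball_topology (CPM X) (sup_dist X))"
    by (auto simp: separating_at_def)
  fix U assume "openin (ball_topology (CPM X) (sup_dist X)) U \<and> U \<noteq> {}"
  then obtain d r where d: "d \<in> CPM X" and "r > 0"
    and r: "{e \<in> CPM X. sup_dist X d e < ennreal r} \<subseteq> U"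
    unfolding openin_ball_topology by blast
  \<comment> \<open>The factor \<open>r / 2\<close> keeps the supremum strictly below \<open>r\<close>.\<close>
  define e where "e x y = d x y + r / 2 * w x y" for x y
  have e: "e \<in> CPM X"
    unfolding e_def using \<open>r > 0\<close> by (intro CPM_add_scaled d w) simp
  have nonneg: "0 \<le> d x y" "0 \<le> w x y" if "x \<in> topspace X" "y \<in> topspace X" for x y
    using d w that by (auto simp: CPM_iff pseudometric_on_def)
  have "\<bar>d x y - e x y\<bar> \<le> r / 2" if "x \<in> topspace X" "y \<in> topspace X" for x y
    using nonneg[OF that] bound[of x y] \<open>r > 0\<close> by (simp add: e_def abs_mult mult_left_le)
  then have "sup_dist X d e \<le> ennreal (r / 2)"
    using \<open>r > 0\<close> by (simp add: sup_dist_le_iff)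
  also have "\<dots> < ennreal r" using \<open>r > 0\<close> by (intro ennreal_lessI) auto
  finally have "e \<in> U" using r e by blast
  have "r / 2 * \<epsilon> \<le> e x y" if "x \<in> topspace X" "y \<in> topspace X" "\<epsilon> \<le> w x y" for x y
  proof -
    have "r / 2 * \<epsilon> \<le> r / 2 * w x y" using that(3) \<open>r > 0\<close> by (intro mult_left_mono) auto
    then show ?thesis using nonneg(1)[OF that(1,2)] unfolding e_def by linarith
  qed
  then have "e \<in> separating_at X w \<epsilon>"
    using e \<open>r > 0\<close> \<open>\<epsilon> > 0\<close> unfolding separating_at_def
    by (intro CollectI conjI exI[of _ "r / 2 * \<epsilon>"]) auto
  with \<open>e \<in> U\<close> show "separating_at X w \<epsilon> \<inter> U \<noteq> {}" by blast
qed

lemma separating_at_all_scales_imp_Met: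
  assumes w: "w \<in> Met X" and d: "\<And>n. d \<in> separating_at X w (inverse (Suc n))"
  shows "d \<in> Met X"
proof (rule Met_if_refines_admissible[OF _ w])
  show "d \<in> CPM X" using d by (auto simp: separating_at_def)
  fix \<epsilon> :: real assume "\<epsilon> > 0"
  then obtain n where n: "inverse (Suc n) < \<epsilon>" using reals_Archimedean by blast
  obtain r where "r > 0"
    and "\<forall>x\<in>topspace X. \<forall>y\<in>topspace X. inverse (Suc n) \<le> w x y \<longrightarrow> r \<le> d x y"
    using d[of n] unfolding separating_at_def by blast
  then show "\<exists>r>0. \<forall>x\<in>topspace X. \<forall>y\<in>topspace X. d x y < r \<longrightarrow> w x y < \<epsilon>"
    using n by (intro exI[of _ r]) (meson less_trans not_le)
qed

lemma comeager_in_Met: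
  assumes "metrizable_space X"
  shows "comeager_in (ball_topology (CPM X) (sup_dist X)) (Met X)"
proof -
  obtain w where w: "w \<in> Met X" "\<And>x y. w x y \<le> 1"
    using bounded_admissible_metric_exists[OF assms] by blast
  define G where "G n = separating_at X w (inverse (Suc n))" for n
  have "w \<in> CPM X" using w Met_subset_CPM by blast
  then have "dense_in (ball_topology (CPM X) (sup_dist X)) (G n)" for n
    unfolding G_def using w(2) by (intro dense_in_separating_at) auto
  moreover have "(\<Inter>n. G n) \<subseteq> Met X"
    using separating_at_all_scales_imp_Met[OF w(1)] by (auto simp: G_def)
  ultimately show ?thesis
    unfolding comeager_in_def
    by (intro conjI exI[of _ G]) (auto simp: G_def openin_separating_at Met_subset_CPM)
qed

theorem theorem1p3:
  fixes X :: "'a topology"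
  assumes "metrizable_space X"
  shows "comeager_in (ball_topology (CPM X) (sup_dist X)) (Met X)
    \<and> Baire_space (ball_topology (Met X) (sup_dist X))"
  using comeager_in_Met[OF assms]
    Baire_space_comeager_subtopology[OF Baire_space_CPM comeager_in_Met[OF assms]]
  by (simp add: ball_topology_Met)

end
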